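(* Let $p\in[1,+\infty)$ and let $E$ be a Banach space. If $f\colon E\to E$ is Fréchet differentiable with derivative $f'\colon E\to\mathcal L(E)$ that is Hölder continuous on bounded sets with exponent $\frac1p$, then the composition operator $C_f$ maps $bv_1(E)$ into $bv_p(E)$ and is Lipschitz continuous on bounded sets.
   Context: $E$ is a Banach space over $\mathbb R$ or $\mathbb C$ with norm $\|\cdot\|$. $\mathcal L(E)$ is the Banach space of all continuous linear operators $T\colon E\to E$ with the operator norm. For a map $f\colon E\to E$, the composition operator $C_f$ assigns to a sequence $x\colon\mathbb N\to E$ the sequence $C_f(x)$ with $C_f(x)(n)=f(x(n))$ for all $n\in\mathbb N$. For $p\in[1,+\infty)$, $bv_p(E)$ is the space of all sequences $x\colon\mathbb N\to E$ with $\sum_{n=1}^\infty\|x(n+1)-x(n)\|^p<+\infty$, with norm $\|x\|_{bv_p}=\|x(1)\|+\bigl(\sum_{n=1}^\infty\|x(n+1)-x(n)\|^p\bigr)^{1/p}$. A map $F\colon X\to Y$ between normed spaces is Hölder continuous on bounded sets with exponent $\alpha\in(0,1]$ if for every $r>0$ there exists $L_r\ge0$ such that $\|F(x)-F(y)\|_Y\le L_r\|x-y\|_X^\alpha$ for all $x,y$ in the closed ball of $X$ with center $0$ and radius $r$; for $\alpha=1$ it is called Lipschitz continuous on bounded sets. *)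

theory Defs
  imports "HOL-Analysis.Analysis"
begin

text \<open>
  Banach spaces are types of class \<open>banach\<close>, hence real. A complex Banach space is covered by
  restricting scalars: the norms on it and on its operators are unchanged, and a complex
  Frechet derivative is in particular a real one. Sequences are indexed from 0 instead of 1.
\<close>

definition bv :: "real \<Rightarrow> (nat \<Rightarrow> 'a::real_normed_vector) set" where
  "bv p = {x. summable (\<lambda>n. norm (x (Suc n) - x n) powr p)}"

definition bv_norm :: "real \<Rightarrow> (nat \<Rightarrow> 'a::real_normed_vector) \<Rightarrow> real" where
  "bv_norm p x = norm (x 0) + (\<Sum>n. norm (x (Suc n) - x n) powr p) powr (1 / p)"

definition composition_op :: "('a \<Rightarrow> 'a) \<Rightarrow> (nat \<Rightarrow> 'a) \<Rightarrow> nat \<Rightarrow> 'a" where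
  "composition_op f x = (\<lambda>n. f (x n))"

text \<open>
  The spaces \<open>bv p\<close> are not types, so the domain is given by a carrier \<open>X\<close> and a norm \<open>NX\<close>, and
  the codomain by its norm \<open>NY\<close>. That \<open>F\<close> maps \<open>X\<close> into the intended codomain is to be stated
  separately. Subtraction of sequences is pointwise.
\<close>

definition holder_on_bounded ::
    "real \<Rightarrow> 'x::minus set \<Rightarrow> ('x \<Rightarrow> real) \<Rightarrow> ('y::minus \<Rightarrow> real) \<Rightarrow> ('x \<Rightarrow> 'y) \<Rightarrow> bool" where
  "holder_on_bounded \<alpha> X NX NY F \<longleftrightarrow>
    (\<forall>r>0. \<exists>L\<ge>0. \<forall>x\<in>X. \<forall>y\<in>X. NX x \<le> r \<longrightarrow> NX y \<le> r \<longrightarrow>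
      NY (F x - F y) \<le> L * NX (x - y) powr \<alpha>)"

abbreviation lipschitz_on_bounded ::
    "'x::minus set \<Rightarrow> ('x \<Rightarrow> real) \<Rightarrow> ('y::minus \<Rightarrow> real) \<Rightarrow> ('x \<Rightarrow> 'y) \<Rightarrow> bool" where
  "lipschitz_on_bounded \<equiv> holder_on_bounded 1"

end

theory Submission
  imports Defs
begin

text \<open>
  Put \<open>u = x - y\<close>, \<open>z\<^sub>t = y + t u\<close>. The \<open>n\<close>-th increment of \<open>f \<circ> x - f \<circ> y\<close> is \<open>g 1 - g 0\<close> for
  \<open>g t = f (z\<^sub>t (n + 1)) - f (z\<^sub>t n)\<close>, whose derivative is
  \<open>f' (z\<^sub>t (n + 1)) (u (n + 1) - u n) + (f' (z\<^sub>t (n + 1)) - f' (z\<^sub>t n)) (u n)\<close>. By the mean value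
  inequality and the Hoelder condition the increment is thus bounded by
  \<open>M \<parallel>u (n + 1) - u n\<parallel> + H \<parallel>u\<parallel> (\<parallel>x (n + 1) - x n\<parallel> + \<parallel>y (n + 1) - y n\<parallel>) powr (1 / p)\<close>.
  The \<open>p\<close>-th powers of both summands are summable, with sums of order \<open>\<parallel>u\<parallel> powr p\<close>. Comparing \<open>x\<close>
  with the zero sequence also gives that \<open>f \<circ> x\<close> lies in \<open>bv p\<close>.
\<close>

section \<open>Sequences of bounded variation\<close>

lemma mem_bv_1_iff: "x \<in> bv 1 \<longleftrightarrow> summable (\<lambda>n. norm (x (Suc n) - x n))"
  by (simp add: bv_def)

lemma bv_norm_1_eq:
  assumes "x \<in> bv 1"
  shows "bv_norm 1 x = norm (x 0) + (\<Sum>n. norm (x (Suc n) - x n))"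
  using assms by (simp add: bv_norm_def mem_bv_1_iff suminf_nonneg)

lemma bv_1_diff:
  fixes x y :: "nat \<Rightarrow> 'a::real_normed_vector"
  assumes "x \<in> bv 1" "y \<in> bv 1"
  shows "x - y \<in> bv 1"
  unfolding mem_bv_1_iff
proof (rule summable_comparison_test')
  show "summable (\<lambda>n. norm (x (Suc n) - x n) + norm (y (Suc n) - y n))"
    using assms by (intro summable_add) (simp_all add: mem_bv_1_iff)
  fix n
  have "(x - y) (Suc n) - (x - y) n = (x (Suc n) - x n) - (y (Suc n) - y n)"
    by simp
  then show "norm (norm ((x - y) (Suc n) - (x - y) n))
      \<le> norm (x (Suc n) - x n) + norm (y (Suc n) - y n)"
    by (simp only: real_norm_def abs_norm_cancel norm_triangle_ineq4)
qed

text \<open>Telescoping from \<open>x 0\<close>. A bound on the variation norm thus confines all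
  values to one ball of \<open>'a\<close>, where a single Hoelder constant of the derivative
  applies.\<close>

lemma norm_le_bv_norm_1:
  assumes "x \<in> bv 1"
  shows "norm (x n) \<le> bv_norm 1 x"
proof -
  have "x n = x 0 + (\<Sum>k<n. x (Suc k) - x k)"
    by (simp add: sum_lessThan_telescope)
  then have "norm (x n) \<le> norm (x 0) + norm (\<Sum>k<n. x (Suc k) - x k)"
    by (metis norm_triangle_ineq)
  also have "\<dots> \<le> norm (x 0) + (\<Sum>k<n. norm (x (Suc k) - x k))"
    using norm_sum by auto
  also have "\<dots> \<le> norm (x 0) + (\<Sum>k. norm (x (Suc k) - x k))"
    using assms by (intro add_left_mono sum_le_suminf) (auto simp: mem_bv_1_iff)
  finally show ?thesis
    using assms by (simp add: bv_norm_1_eq)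
qed

section \<open>Estimates for increments\<close>

lemma powr_add_le:
  fixes a b p :: real
  assumes "0 \<le> a" "0 \<le> b" "0 \<le> p"
  shows "(a + b) powr p \<le> 2 powr p * (a powr p + b powr p)"
proof -
  have "(a + b) powr p \<le> (2 * max a b) powr p"
    using assms by (intro powr_mono2) auto
  also have "\<dots> = 2 powr p * max a b powr p"
    using assms by (simp add: powr_mult)
  also have "\<dots> \<le> 2 powr p * (a powr p + b powr p)"
    by (intro mult_left_mono) (auto simp: max_def)
  finally show ?thesis .
qed

text \<open>Here \<open>x\<close>, \<open>x'\<close> and \<open>y\<close>, \<open>y'\<close> stand
  for consecutive terms of two sequences. Estimating \<open>f x' - f y'\<close> and
  \<open>f x - f y\<close> separately would leave a multiple of \<open>norm (x - y)\<close>, which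
  need not be p-summable along the sequences. Moving along both segments with the same parameter
  avoids this.\<close>

lemma second_difference_bound:
  fixes f :: "'a::real_normed_vector \<Rightarrow> 'b::real_normed_vector"
  assumes der: "\<And>x. (f has_derivative blinfun_apply (f' x)) (at x)"
    and bdd: "\<And>z. norm z \<le> r \<Longrightarrow> norm (f' z) \<le> M"
    and holder: "\<And>z w. norm z \<le> r \<Longrightarrow> norm w \<le> r \<Longrightarrow> norm (f' z - f' w) \<le> H * norm (z - w) powr \<alpha>"
    and "0 \<le> H" "0 \<le> \<alpha>"
    and le_r: "norm x \<le> r" "norm x' \<le> r" "norm y \<le> r" "norm y' \<le> r"
  shows "norm ((f x' - f y') - (f x - f y))
    \<le> M * norm ((x' - y') - (x - y))
      + H * norm (x - y) * (norm (x' - x) + norm (y' - y)) powr \<alpha>"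
    (is "_ \<le> ?B")
proof -
  define z0 where "z0 t = y + t *\<^sub>R (x - y)" for t :: real
  define z1 where "z1 t = y' + t *\<^sub>R (x' - y')" for t :: real
  define g where "g t = f (z1 t) - f (z0 t)" for t
  define g' where "g' t s = f' (z1 t) (s *\<^sub>R (x' - y')) - f' (z0 t) (s *\<^sub>R (x - y))" for t s
  have der_g: "(g has_derivative g' t) (at t within {0..1})" for t
    unfolding g_def g'_def z0_def z1_def
    by (rule has_derivative_at_withinI)
      (auto intro!: derivative_eq_intros has_derivative_compose[OF _ der])
  have onorm_g': "onorm (g' t) \<le> ?B" if t: "t \<in> {0..1}" for t
  proof (rule onorm_le)
    fix s :: real
    have in_ball: "norm (z0 t) \<le> r" "norm (z1 t) \<le> r"
      using convexD_alt[OF convex_cball[of 0 r], of y x t]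
        convexD_alt[OF convex_cball[of 0 r], of y' x' t] t le_r
      by (simp_all add: z0_def z1_def algebra_simps)
    \<comment> \<open>A convex combination of the two increments; replacing both weights by 1 makes
      the bound independent of \<open>t\<close>.\<close>
    have "z1 t - z0 t = (1 - t) *\<^sub>R (y' - y) + t *\<^sub>R (x' - x)"
      by (simp add: z0_def z1_def algebra_simps)
    then have "norm (z1 t - z0 t) \<le> (1 - t) * norm (y' - y) + t * norm (x' - x)"
      using t by (metis norm_triangle_ineq norm_scaleR abs_of_nonneg atLeastAtMost_iff diff_ge_0_iff_ge)
    also have "\<dots> \<le> 1 * norm (y' - y) + 1 * norm (x' - x)"
      using t by (intro add_mono mult_right_mono) auto
    finally have dz: "norm (z1 t - z0 t) \<le> norm (x' - x) + norm (y' - y)"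
      by simp
    have "norm (f' (z1 t) ((x' - y') - (x - y))) \<le> M * norm ((x' - y') - (x - y))"
      by (rule order_trans[OF norm_blinfun]) (intro mult_right_mono bdd in_ball norm_ge_zero)
    moreover have "norm ((f' (z1 t) - f' (z0 t)) (x - y))
        \<le> H * norm (x - y) * (norm (x' - x) + norm (y' - y)) powr \<alpha>"
    proof -
      have "norm (f' (z1 t) - f' (z0 t)) \<le> H * norm (z1 t - z0 t) powr \<alpha>"
        by (intro holder in_ball)
      also have "\<dots> \<le> H * (norm (x' - x) + norm (y' - y)) powr \<alpha>"
        using \<open>0 \<le> H\<close> \<open>0 \<le> \<alpha>\<close> dz by (intro mult_left_mono powr_mono2) auto
      finally have "norm (f' (z1 t) - f' (z0 t)) * norm (x - y)
          \<le> H * (norm (x' - x) + norm (y' - y)) powr \<alpha> * norm (x - y)"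
        by (rule mult_right_mono) simp
      then show ?thesis
        using norm_blinfun[of "f' (z1 t) - f' (z0 t)" "x - y"] by (simp add: mult_ac)
    qed
    \<comment> \<open>The term \<open>f' (z1 t) (s *\<^sub>R (x - y))\<close> is added and
      subtracted.\<close>
    moreover have "g' t s = s *\<^sub>R (f' (z1 t) ((x' - y') - (x - y)) + (f' (z1 t) - f' (z0 t)) (x - y))"
      by (simp add: g'_def blinfun.bilinear_simps algebra_simps)
    ultimately have "norm (g' t s) \<le> \<bar>s\<bar> * ?B"
      by (auto intro!: mult_left_mono order_trans[OF norm_triangle_ineq])
    then show "norm (g' t s) \<le> ?B * norm s"
      by (simp add: mult.commute)
  qed
  have "norm (g 1 - g 0) \<le> ?B * norm (1 - 0 :: real)"
    by (rule differentiable_bound[of "{0..1}" g g']) (use der_g onorm_g' in auto)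
  moreover have "g 1 - g 0 = (f x' - f y') - (f x - f y)"
    by (simp add: g_def z0_def z1_def)
  ultimately show ?thesis
    by simp
qed

text \<open>The factor depends on the sequences only through the radius \<open>r\<close>, as a
  Lipschitz constant on a ball must. Its summand \<open>M\<close> comes from the initial terms, the
  rest from the p-th root of the summed increments.\<close>

lemma composition_op_diff_bound:
  fixes f :: "'a::real_normed_vector \<Rightarrow> 'a"
  assumes "1 \<le> p"
    and der: "\<And>x. (f has_derivative blinfun_apply (f' x)) (at x)"
    and bdd: "\<And>z. norm z \<le> r \<Longrightarrow> norm (f' z) \<le> M"
    and holder: "\<And>z w. norm z \<le> r \<Longrightarrow> norm w \<le> r
      \<Longrightarrow> norm (f' z - f' w) \<le> H * norm (z - w) powr (1 / p)"
    and "0 \<le> M" "0 \<le> H"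
    and x: "x \<in> bv 1" "bv_norm 1 x \<le> r"
    and y: "y \<in> bv 1" "bv_norm 1 y \<le> r"
  shows "composition_op f x - composition_op f y \<in> bv p"
    and "bv_norm p (composition_op f x - composition_op f y)
      \<le> (M + 2 * (M powr p + H powr p * (2 * r)) powr (1 / p)) * bv_norm 1 (x - y)"
proof -
  define F where "F = composition_op f x - composition_op f y"
  define \<delta> where "\<delta> = bv_norm 1 (x - y)"
  define d where "d n = norm ((x - y) (Suc n) - (x - y) n)" for n
  define v where "v n = norm (x (Suc n) - x n) + norm (y (Suc n) - y n)" for n
  define K where "K = M powr p + H powr p * (2 * r)"
  \<comment> \<open>A majorant linear in the summable \<open>d\<close> and \<open>v\<close>: one
    factor \<open>d n\<close> is kept and the other p - 1 are bounded by \<delta>, while the p-th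
    power turns \<open>v n powr (1 / p)\<close> into \<open>v n\<close>.\<close>
  define b where "b n = 2 powr p * (M powr p * \<delta> powr (p - 1) * d n + H powr p * \<delta> powr p * v n)" for n
  have x_le: "norm (x n) \<le> r" and y_le: "norm (y n) \<le> r" for n
    using norm_le_bv_norm_1[OF x(1), of n] norm_le_bv_norm_1[OF y(1), of n] x(2) y(2) by auto
  have "0 \<le> r"
    using x_le[of 0] norm_ge_zero[of "x 0"] by linarith
  have xy: "x - y \<in> bv 1"
    using x(1) y(1) by (rule bv_1_diff)
  have u_le: "norm (x n - y n) \<le> \<delta>" for n
    using norm_le_bv_norm_1[OF xy, of n] by (simp add: \<delta>_def)
  then have "0 \<le> \<delta>"
    using norm_ge_zero order_trans by blast
  have summable_d: "summable d"
    using xy unfolding d_def mem_bv_1_iff .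
  have suminf_d: "suminf d \<le> \<delta>"
    unfolding \<delta>_def d_def bv_norm_1_eq[OF xy] by simp
  have d_le: "d n \<le> \<delta>" for n
    using sum_le_suminf[OF summable_d, of "{n}"] suminf_d by (simp add: d_def)
  have summable_v: "summable v"
    using x(1) y(1) unfolding v_def by (intro summable_add) (simp_all add: mem_bv_1_iff)
  have "suminf v = (\<Sum>n. norm (x (Suc n) - x n)) + (\<Sum>n. norm (y (Suc n) - y n))"
    unfolding v_def using x(1) y(1) by (intro suminf_add[symmetric]) (simp_all add: mem_bv_1_iff)
  moreover have "(\<Sum>n. norm (x (Suc n) - x n)) \<le> r" "(\<Sum>n. norm (y (Suc n) - y n)) \<le> r"
    using x(2) y(2) norm_ge_zero[of "x 0"] norm_ge_zero[of "y 0"]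
    unfolding bv_norm_1_eq[OF x(1)] bv_norm_1_eq[OF y(1)] by linarith+
  ultimately have suminf_v: "suminf v \<le> 2 * r"
    by simp
  have "0 \<le> d n" "0 \<le> v n" for n
    by (simp_all add: d_def v_def)
  \<comment> \<open>This includes \<delta> = 0 with p = 1, as \<open>0 powr 0\<close> is 0.\<close>
  have powr_\<delta>: "\<delta> powr (p - 1) * \<delta> = \<delta> powr p"
    using powr_add[of \<delta> "p - 1" 1] \<open>0 \<le> \<delta>\<close> by simp
  have term_le: "norm (F (Suc n) - F n) powr p \<le> b n" for n
  proof -
    have "norm (F (Suc n) - F n) \<le> M * d n + H * norm (x n - y n) * v n powr (1 / p)"
      using second_difference_bound[where f = f and f' = f' and r = r and M = M and H = H
          and \<alpha> = "1 / p" and x = "x n" and y = "y n" and x' = "x (Suc n)" and y' = "y (Suc n)",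
          OF der bdd holder \<open>0 \<le> H\<close> _ x_le x_le y_le y_le] \<open>1 \<le> p\<close>
      by (simp add: F_def composition_op_def d_def v_def)
    also have "\<dots> \<le> M * d n + H * \<delta> * v n powr (1 / p)"
      using \<open>0 \<le> H\<close> u_le by (intro add_left_mono mult_right_mono mult_left_mono) auto
    finally have "norm (F (Suc n) - F n) powr p \<le> (M * d n + H * \<delta> * v n powr (1 / p)) powr p"
      using \<open>1 \<le> p\<close> by (intro powr_mono2) auto
    also have "\<dots> \<le> 2 powr p * ((M * d n) powr p + (H * \<delta> * v n powr (1 / p)) powr p)"
      using \<open>0 \<le> M\<close> \<open>0 \<le> H\<close> \<open>0 \<le> \<delta>\<close> \<open>0 \<le> d n\<close> \<open>1 \<le> p\<close> by (intro powr_add_le) auto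
    also have "(H * \<delta> * v n powr (1 / p)) powr p = H powr p * \<delta> powr p * v n"
      using \<open>0 \<le> H\<close> \<open>0 \<le> \<delta>\<close> \<open>0 \<le> v n\<close> \<open>1 \<le> p\<close> by (simp add: powr_mult powr_powr)
    also have "(M * d n) powr p \<le> M powr p * \<delta> powr (p - 1) * d n"
    proof -
      have "d n powr p = d n powr (p - 1) * d n"
        using powr_add[of "d n" "p - 1" 1] \<open>0 \<le> d n\<close> by simp
      also have "\<dots> \<le> \<delta> powr (p - 1) * d n"
        using \<open>0 \<le> d n\<close> d_le[of n] \<open>1 \<le> p\<close> by (intro mult_right_mono powr_mono2) auto
      finally have "M powr p * d n powr p \<le> M powr p * (\<delta> powr (p - 1) * d n)"
        by (rule mult_left_mono) simp
      then show ?thesis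
        using \<open>0 \<le> M\<close> \<open>0 \<le> d n\<close> by (simp add: powr_mult mult.assoc)
    qed
    finally show ?thesis
      by (simp add: b_def)
  qed
  have summable_b: "summable b"
    unfolding b_def by (intro summable_mult summable_add summable_d summable_v)
  have summable_F: "summable (\<lambda>n. norm (F (Suc n) - F n) powr p)"
    by (rule summable_comparison_test'[OF summable_b]) (use term_le in simp)
  then show "composition_op f x - composition_op f y \<in> bv p"
    unfolding F_def by (simp add: bv_def)
  have "suminf b = 2 powr p * (M powr p * \<delta> powr (p - 1) * suminf d + H powr p * \<delta> powr p * suminf v)"
    unfolding b_def
    by (simp add: suminf_mult suminf_add[symmetric] summable_add summable_mult summable_d summable_v)
  also have "\<dots> \<le> 2 powr p * (M powr p * \<delta> powr (p - 1) * \<delta> + H powr p * \<delta> powr p * (2 * r))"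
    using suminf_d suminf_v by (intro mult_left_mono add_mono) auto
  also have "\<dots> = 2 powr p * (\<delta> powr p * K)"
    using powr_\<delta> by (simp add: K_def algebra_simps)
  finally have "(\<Sum>n. norm (F (Suc n) - F n) powr p) \<le> 2 powr p * (\<delta> powr p * K)"
    using suminf_le[OF term_le summable_F summable_b] by simp
  then have "(\<Sum>n. norm (F (Suc n) - F n) powr p) powr (1 / p)
      \<le> (2 powr p * (\<delta> powr p * K)) powr (1 / p)"
    using \<open>1 \<le> p\<close> summable_F by (intro powr_mono2 suminf_nonneg) auto
  also have "\<dots> = 2 * \<delta> * K powr (1 / p)"
    using \<open>1 \<le> p\<close> \<open>0 \<le> \<delta>\<close> \<open>0 \<le> r\<close> by (simp add: K_def powr_mult powr_powr)
  finally have "(\<Sum>n. norm (F (Suc n) - F n) powr p) powr (1 / p) \<le> 2 * \<delta> * K powr (1 / p)" .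
  \<comment> \<open>The initial term is no increment; the mean value inequality on the convex ball
    handles it.\<close>
  moreover have "norm (F 0) \<le> M * \<delta>"
  proof -
    have "norm (f (x 0) - f (y 0)) \<le> M * norm (x 0 - y 0)"
      by (rule differentiable_bound[of "cball 0 r" f "\<lambda>z. blinfun_apply (f' z)"])
        (use x_le y_le bdd in \<open>auto simp: norm_blinfun.rep_eq[symmetric] intro: has_derivative_at_withinI der\<close>)
    also have "\<dots> \<le> M * \<delta>"
      using u_le \<open>0 \<le> M\<close> by (intro mult_left_mono)
    finally show ?thesis
      by (simp add: F_def composition_op_def)
  qed
  ultimately have "bv_norm p F \<le> (M + 2 * K powr (1 / p)) * \<delta>"
    by (simp add: bv_norm_def algebra_simps)
  then show "bv_norm p (composition_op f x - composition_op f y)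
      \<le> (M + 2 * (M powr p + H powr p * (2 * r)) powr (1 / p)) * bv_norm 1 (x - y)"
    by (simp add: F_def K_def \<delta>_def)
qed

theorem theorem34:
  fixes p :: real
    and f :: "'a::banach \<Rightarrow> 'a"
    and f' :: "'a \<Rightarrow> 'a \<Rightarrow>\<^sub>L 'a"
  assumes "1 \<le> p"
    and "\<And>x. (f has_derivative blinfun_apply (f' x)) (at x)"
    and "holder_on_bounded (1 / p) UNIV norm norm f'"
  shows "composition_op f ` bv 1 \<subseteq> bv p
    \<and> lipschitz_on_bounded (bv 1) (bv_norm 1) (bv_norm p) (composition_op f)"
proof -
  have bound: "\<exists>L\<ge>0. \<forall>x\<in>bv 1. \<forall>y\<in>bv 1. bv_norm 1 x \<le> r \<longrightarrow> bv_norm 1 y \<le> r \<longrightarrow>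
      composition_op f x - composition_op f y \<in> bv p
      \<and> bv_norm p (composition_op f x - composition_op f y) \<le> L * bv_norm 1 (x - y)"
    if "0 < r" for r
  proof -
    obtain H where "0 \<le> H"
      and H: "\<forall>z\<in>UNIV. \<forall>w\<in>UNIV. norm z \<le> r \<longrightarrow> norm w \<le> r
        \<longrightarrow> norm (f' z - f' w) \<le> H * norm (z - w) powr (1 / p)"
      using assms(3) \<open>0 < r\<close> unfolding holder_on_bounded_def by meson
    have holder: "norm (f' z - f' w) \<le> H * norm (z - w) powr (1 / p)"
      if "norm z \<le> r" "norm w \<le> r" for z w
      using H that by simp
    \<comment> \<open>Comparing \<open>f' z\<close> with \<open>f' 0\<close> shows that a Hoelder
      derivative is bounded on the ball.\<close>
    define M where "M = norm (f' 0) + H * r powr (1 / p)"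
    have "0 \<le> M"
      using \<open>0 \<le> H\<close> by (simp add: M_def)
    have bdd: "norm (f' z) \<le> M" if "norm z \<le> r" for z
    proof -
      have "norm (f' z) \<le> norm (f' 0) + norm (f' z - f' 0)"
        by (rule norm_triangle_sub)
      also have "norm (f' z - f' 0) \<le> H * norm (z - 0) powr (1 / p)"
        using that \<open>0 < r\<close> by (intro holder) auto
      also have "\<dots> \<le> H * r powr (1 / p)"
        using that \<open>0 \<le> H\<close> assms(1) by (intro mult_left_mono powr_mono2) auto
      finally show ?thesis
        by (simp add: M_def)
    qed
    have "0 \<le> M + 2 * (M powr p + H powr p * (2 * r)) powr (1 / p)"
      using \<open>0 \<le> M\<close> by simp
    then show ?thesis
      using composition_op_diff_bound[OF assms(1,2) bdd holder \<open>0 \<le> M\<close> \<open>0 \<le> H\<close>] by blast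
  qed
  have "composition_op f x \<in> bv p" if x: "x \<in> bv 1" for x
  proof -
    have nonneg: "0 \<le> bv_norm 1 x"
      using norm_le_bv_norm_1[OF x, of 0] norm_ge_zero[of "x 0"] by linarith
    have "(\<lambda>_. 0 :: 'a) \<in> bv 1" "bv_norm 1 (\<lambda>_. 0 :: 'a) = 0"
      by (simp_all add: bv_def bv_norm_def)
    \<comment> \<open>Adding 1 makes the radius positive even if \<open>bv_norm 1 x\<close> is
      0.\<close>
    then have "composition_op f x - composition_op f (\<lambda>_. 0) \<in> bv p"
      using bound[of "bv_norm 1 x + 1"] x nonneg by force
    \<comment> \<open>The subtracted sequence is constantly \<open>f 0\<close>, so the increments
      are those of \<open>composition_op f x\<close>.\<close>
    then show ?thesis
      by (simp add: bv_def composition_op_def)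
  qed
  moreover have "lipschitz_on_bounded (bv 1) (bv_norm 1) (bv_norm p) (composition_op f)"
    unfolding holder_on_bounded_def
  proof (intro allI impI)
    fix r :: real
    assume "0 < r"
    \<comment> \<open>The outer \<open>powr\<close> ensures this whatever value the series has; it
      lets \<open>powr 1\<close> be removed.\<close>
    have nonneg: "0 \<le> bv_norm 1 (x - y)" for x y :: "nat \<Rightarrow> 'a"
      by (simp add: bv_norm_def)
    show "\<exists>L\<ge>0. \<forall>x\<in>bv 1. \<forall>y\<in>bv 1. bv_norm 1 x \<le> r \<longrightarrow> bv_norm 1 y \<le> r \<longrightarrow>
        bv_norm p (composition_op f x - composition_op f y) \<le> L * bv_norm 1 (x - y) powr 1"
      using bound[OF \<open>0 < r\<close>] unfolding powr_one[OF nonneg] by blast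
  qed
  ultimately show ?thesis
    by blast
qed

end
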